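(* Let $\Omega\subset\mathbb{R}^n$ be a domain for which there is a constant $A>0$ such that $|\Omega(x_0,\rho)|\ge A\rho^n$ for all $x_0\in\Omega$ and all $\rho<\operatorname{diam}\Omega$. For $1\le p<\infty$ and $0\le\lambda<n$, the Morrey space and the variant Morrey-Campanato class coincide: $L^{p,\lambda}(\Omega)=\bar{\mathcal{L}}^{p,\lambda}(\Omega)$.
   Context: $Q(x,\rho)$ denotes the cube in $\mathbb{R}^n$ with sides parallel to the coordinate axes, center $x$ and side length $2\rho$, and $\Omega(x_0,\rho):=Q(x_0,\rho)\cap\Omega$. For a set $E$ of positive finite measure, $|f|_{E}:=\frac{1}{|E|}\int_{E}|f(y)|\,dy$. $L^{p,\lambda}(\Omega)$ is the set of $f\in L^p(\Omega)$ with $\sup_{x_0\in\Omega,\rho>0}\rho^{-\lambda}\int_{\Omega(x_0,\rho)}|f(x)|^p\,dx<\infty$. $\bar{\mathcal{L}}^{p,\lambda}(\Omega)$ is the set of $f\in L^p(\Omega)$ with $\sup_{x_0\in\Omega,\rho>0}\rho^{-\lambda}\int_{\Omega(x_0,\rho)}\big|f(x)-|f|_{\Omega(x_0,\rho)}\big|^p\,dx<\infty$. *)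

theory Defs
  imports "HOL-Analysis.Analysis"
begin

text \<open>
  Open cubes are used; the closed cube differs from the open one by a null set.
\<close>

definition cube :: "real ^ 'n \<Rightarrow> real \<Rightarrow> (real ^ 'n) set"
  where "cube x \<rho> = box (x - vec \<rho>) (x + vec \<rho>)"

definition subcube :: "(real ^ 'n) set \<Rightarrow> real ^ 'n \<Rightarrow> real \<Rightarrow> (real ^ 'n) set"
  where "subcube \<Omega> x\<^sub>0 \<rho> = cube x\<^sub>0 \<rho> \<inter> \<Omega>"

text \<open>
  Unlike \<^const>\<open>diameter\<close>, which is \<open>0\<close> on unbounded sets, this takes the value \<open>\<infinity>\<close> there.
\<close>

definition ediameter :: "'a::metric_space set \<Rightarrow> ennreal"
  where "ediameter S = (SUP (x, y) \<in> S \<times> S. ennreal (dist x y))"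

definition abs_mean :: "(real ^ 'n \<Rightarrow> real) \<Rightarrow> (real ^ 'n) set \<Rightarrow> real"
  where "abs_mean f E = (LINT y|lebesgue_on E. \<bar>f y\<bar>) / measure lebesgue E"

text \<open>
  The spaces below are sets of functions rather than of classes modulo equality almost everywhere
  on \<open>\<Omega>\<close>. The functions are defined on the whole of the ambient space, but membership depends only
  on their values on \<open>\<Omega>\<close>, and only up to a null set. The exponent usually called lambda is \<open>\<kappa>\<close>.
\<close>

definition Lp :: "real \<Rightarrow> (real ^ 'n) set \<Rightarrow> (real ^ 'n \<Rightarrow> real) set"
  where "Lp p \<Omega> = {f \<in> borel_measurable (lebesgue_on \<Omega>).
           integrable (lebesgue_on \<Omega>) (\<lambda>x. \<bar>f x\<bar> powr p)}"

definition morrey :: "real \<Rightarrow> real \<Rightarrow> (real ^ 'n) set \<Rightarrow> (real ^ 'n \<Rightarrow> real) set"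
  where "morrey p \<kappa> \<Omega> = {f \<in> Lp p \<Omega>.
           (SUP (x\<^sub>0, \<rho>) \<in> \<Omega> \<times> {0<..}. ennreal (\<rho> powr (- \<kappa>)) *
              (\<integral>\<^sup>+ x. ennreal (\<bar>f x\<bar> powr p) \<partial>lebesgue_on (subcube \<Omega> x\<^sub>0 \<rho>))) < \<infinity>}"

definition abs_campanato :: "real \<Rightarrow> real \<Rightarrow> (real ^ 'n) set \<Rightarrow> (real ^ 'n \<Rightarrow> real) set"
  where "abs_campanato p \<kappa> \<Omega> = {f \<in> Lp p \<Omega>.
           (SUP (x\<^sub>0, \<rho>) \<in> \<Omega> \<times> {0<..}. ennreal (\<rho> powr (- \<kappa>)) *
              (\<integral>\<^sup>+ x. ennreal (\<bar>f x - abs_mean f (subcube \<Omega> x\<^sub>0 \<rho>)\<bar> powr p)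
                 \<partial>lebesgue_on (subcube \<Omega> x\<^sub>0 \<rho>))) < \<infinity>}"

end

theory Submission
  imports Defs
begin

text \<open>
  Write \<open>E(\<rho>) = subcube \<Omega> x \<rho>\<close>, let \<open>m(\<rho>)\<close> be the mean of \<open>\<bar>f\<bar>\<close> over \<open>E(\<rho>)\<close>, and let
  \<open>n\<close> be the dimension. The triangle inequality and \<open>(a + b)\<^sup>p \<le> 2\<^sup>p (a\<^sup>p + b\<^sup>p)\<close> show that the
  integrals of \<open>\<bar>f\<bar>\<^sup>p\<close> and of \<open>\<bar>f - m(\<rho>)\<bar>\<^sup>p\<close> over \<open>E(\<rho>)\<close> control each other up to the error
  \<open>m(\<rho>)\<^sup>p \<bar>E(\<rho>)\<bar>\<close>, so everything depends on bounding this error by a multiple of \<open>\<rho>\<^sup>\<kappa>\<close>.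

  If \<open>f\<close> is in the Morrey space, Jensen's inequality bounds the error by the integral of \<open>\<bar>f\<bar>\<^sup>p\<close>
  over \<open>E(\<rho>)\<close> (\<open>morrey_subset_abs_campanato\<close>).

  Conversely, let the oscillation of \<open>f\<close> be bounded. Since \<open>m \<ge> 0\<close>, the oscillation of \<open>f\<close> about a
  mean of \<open>\<bar>f\<bar>\<close> dominates that of \<open>\<bar>f\<bar>\<close>, because \<open>\<bar>\<bar>t\<bar> - c\<bar> \<le> \<bar>t - c\<bar>\<close> for \<open>c \<ge> 0\<close>. Jensen's
  inequality on \<open>E(\<rho>) \<subseteq> E(2\<rho>)\<close> and the lower bound on \<open>\<bar>E(\<rho>)\<bar>\<close> then give
  \<open>\<bar>m(\<rho>) - m(2\<rho>)\<bar> \<le> K \<rho>\<^sup>-\<^sup>\<alpha>\<close> with \<open>\<alpha> = (n - \<kappa>) / p\<close> (\<open>abs_mean_subcube_doubling\<close>). Because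
  \<open>\<kappa> < n\<close>, the exponent \<open>\<alpha>\<close> is positive and these increments, summed along \<open>\<rho>, 2\<rho>, 4\<rho>, \<dots>\<close>, form a
  convergent geometric series dominated by its first term (\<open>dyadic_growth_bound\<close>). The summation
  stops at a scale comparable to a fixed \<open>R \<le> diam \<Omega>\<close>, where \<open>m\<close> is bounded in terms of the global
  \<open>L\<^sup>p\<close> norm. Hence \<open>m(\<rho>) \<le> K' \<rho>\<^sup>-\<^sup>\<alpha>\<close> for \<open>\<rho> < R\<close>, which makes the error at most a multiple of
  \<open>\<rho>\<^sup>-\<^sup>p\<^sup>\<alpha> \<rho>\<^sup>n = \<rho>\<^sup>\<kappa>\<close>. For \<open>\<rho> \<ge> R\<close> the global norm suffices, as \<open>\<rho>\<^sup>\<kappa> \<ge> R\<^sup>\<kappa>\<close>. Since \<open>R\<close> can be any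
  positive number up to the diameter, bounded and unbounded \<open>\<Omega>\<close> are treated alike.
\<close>

section \<open>Powers of real numbers\<close>

lemma powr_add_le:
  fixes a b p :: real
  assumes "a \<ge> 0" "b \<ge> 0" "p \<ge> 0"
  shows "(a + b) powr p \<le> 2 powr p * (a powr p + b powr p)"
proof -
  have "(a + b) powr p \<le> (2 * max a b) powr p"
    using assms by (intro powr_mono2) auto
  also have "\<dots> = 2 powr p * max a b powr p"
    using assms by (simp add: powr_mult)
  also have "\<dots> \<le> 2 powr p * (a powr p + b powr p)"
    by (intro mult_left_mono) (auto simp: max_def)
  finally show ?thesis .
qed

text \<open>
  The tangent at \<open>m\<close>, taken with \<open>m\<close> the mean, is what yields Jensen's inequality after
  integration. The point \<open>t = 0\<close> is a separate case: the convexity argument runs on the open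
  half-line, where the power is twice differentiable.
\<close>

lemma powr_above_tangent:
  fixes t m p :: real
  assumes "t \<ge> 0" "m > 0" "p \<ge> 1"
  shows "m powr p + p * m powr (p - 1) * (t - m) \<le> t powr p"
proof (cases "t = 0")
  case True
  have "m powr (p - 1) * m = m powr p"
    using assms by (simp add: powr_diff)
  then have "m powr p + p * m powr (p - 1) * (t - m) = (1 - p) * m powr p"
    using True by (simp add: algebra_simps)
  also have "\<dots> \<le> 0"
    using assms by (simp add: mult_nonpos_nonneg)
  finally show ?thesis
    using True by simp
next
  case False
  have "p * m powr (p - 1) * (t - m) \<le> t powr p - m powr p"
  proof (rule convex_on_imp_above_tangent[where A = "{0<..}"])
    show "convex_on {0<..} (\<lambda>x. x powr p)"
      using assms by (intro powr_convex)
    show "((\<lambda>x. x powr p) has_real_derivative p * m powr (p - 1)) (at m within {0<..})"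
      using assms by (auto intro!: derivative_eq_intros has_field_derivative_powr simp: powr_diff)
  qed (use assms False in \<open>auto simp: interior_open\<close>)
  then show ?thesis by simp
qed

lemma powr_le_imp_le_root:
  fixes D Q \<rho> s p :: real
  assumes "D \<ge> 0" "Q \<ge> 0" "\<rho> > 0" "p > 0" "D powr p \<le> Q * \<rho> powr s"
  shows "D \<le> Q powr (1 / p) * \<rho> powr (s / p)"
proof -
  have "D = (D powr p) powr (1 / p)"
    using assms by (simp add: powr_powr)
  also have "\<dots> \<le> (Q * \<rho> powr s) powr (1 / p)"
    using assms by (intro powr_mono2) auto
  also have "\<dots> = Q powr (1 / p) * \<rho> powr (s / p)"
    using assms by (simp add: powr_mult powr_powr)
  finally show ?thesis .
qed

section \<open>Dyadic iteration\<close>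

lemma dyadic_multiple_in_top_octave:
  fixes r R :: real
  assumes "0 < r" "r < R"
  obtains k where "R / 2 \<le> 2 ^ k * r" "2 ^ k * r < R"
proof -
  obtain j :: nat where "R / r < 2 ^ j"
    using real_arch_pow[of 2 "R / r"] by auto
  then have ex: "\<exists>j. R \<le> 2 ^ j * r"
    using assms by (intro exI[of _ j]) (simp add: field_simps)
  define j where "j = (LEAST j. R \<le> 2 ^ j * r)"
  have j: "R \<le> 2 ^ j * r"
    unfolding j_def using ex by (rule LeastI_ex)
  have "j \<noteq> 0"
    using j assms by (intro notI) simp
  then obtain k where k: "j = Suc k"
    by (cases j) auto
  have "\<not> R \<le> 2 ^ k * r"
    using not_less_Least[of k "\<lambda>j. R \<le> 2 ^ j * r"] k unfolding j_def by auto
  moreover have "R / 2 \<le> 2 ^ k * r"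
    using j unfolding k by simp
  ultimately show ?thesis
    using that by auto
qed

text \<open>
  Along \<open>r, 2r, 4r, \<dots>\<close> the increments decay like powers of \<open>q = 2 powr (-\<alpha>) < 1\<close>. The constant
  \<open>K' = K / (1 - q)\<close> is the sum of the geometric series, that is, the solution of \<open>q K' + K = K'\<close>,
  which is what reproduces the bound in the induction step.
\<close>

lemma dyadic_growth_bound:
  fixes m :: "real \<Rightarrow> real" and \<alpha> K R r :: real
  assumes step: "\<And>r. 0 < r \<Longrightarrow> 2 * r < R \<Longrightarrow> m r \<le> m (2 * r) + K * r powr (- \<alpha>)"
    and "\<alpha> > 0" "K \<ge> 0"
    and "0 < r" "2 ^ k * r < R"
  shows "m r \<le> m (2 ^ k * r) + K / (1 - 2 powr (- \<alpha>)) * r powr (- \<alpha>)"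
  using \<open>0 < r\<close> \<open>2 ^ k * r < R\<close>
proof (induction k arbitrary: r)
  case 0
  have "2 powr (- \<alpha>) < 1"
    using \<open>\<alpha> > 0\<close> by (simp add: powr_less_one)
  then show ?case
    using \<open>K \<ge> 0\<close> by simp
next
  case (Suc k)
  define q where "q = 2 powr (- \<alpha>)"
  have q: "q < 1"
    using \<open>\<alpha> > 0\<close> by (simp add: powr_less_one q_def)
  have "1 * (2 * r) \<le> 2 ^ k * (2 * r)"
    using Suc.prems by (intro mult_right_mono) auto
  also have "\<dots> < R"
    using Suc.prems by (simp add: mult_ac)
  finally have "2 * r < R"
    by simp
  then have "m r \<le> m (2 * r) + K * r powr (- \<alpha>)"
    using step Suc.prems by blast
  also have "m (2 * r) \<le> m (2 ^ k * (2 * r)) + K / (1 - q) * (2 * r) powr (- \<alpha>)"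
    unfolding q_def using Suc.prems by (intro Suc.IH) (auto simp: mult_ac)
  also have "(2 * r) powr (- \<alpha>) = q * r powr (- \<alpha>)"
    using Suc.prems by (simp add: powr_mult q_def)
  also have "m (2 ^ k * (2 * r)) + K / (1 - q) * (q * r powr (- \<alpha>)) + K * r powr (- \<alpha>)
      = m (2 ^ Suc k * r) + K / (1 - q) * r powr (- \<alpha>)"
    using q by (simp add: field_simps)
  finally show ?case
    by (simp add: q_def)
qed

section \<open>Averages of functions in \<open>L\<^sup>p\<close>\<close>

lemma (in finite_measure) integrable_of_integrable_powr:
  fixes h :: "'a \<Rightarrow> real"
  assumes "h \<in> borel_measurable M" "integrable M (\<lambda>x. \<bar>h x\<bar> powr p)" "1 \<le> p"
  shows "integrable M h"
proof (rule Bochner_Integration.integrable_bound)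
  show "integrable M (\<lambda>x. 1 + \<bar>h x\<bar> powr p)"
    using assms by simp
  have "\<bar>t\<bar> \<le> 1 + \<bar>t\<bar> powr p" for t :: real
  proof (cases "\<bar>t\<bar> \<le> 1")
    case False
    then have "\<bar>t\<bar> powr 1 \<le> \<bar>t\<bar> powr p"
      using \<open>1 \<le> p\<close> by (intro powr_mono) auto
    then show ?thesis by simp
  qed (simp add: add_increasing2)
  then show "AE x in M. norm (h x) \<le> norm (1 + \<bar>h x\<bar> powr p)"
    by (simp add: add_nonneg_nonneg)
qed (use assms in auto)

lemma (in finite_measure) integrable_powr_diff_const:
  fixes h :: "'a \<Rightarrow> real"
  assumes "h \<in> borel_measurable M" "integrable M (\<lambda>x. \<bar>h x\<bar> powr p)" "1 \<le> p"
  shows "integrable M (\<lambda>x. \<bar>h x - c\<bar> powr p)"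
proof (rule Bochner_Integration.integrable_bound)
  show "integrable M (\<lambda>x. 2 powr p * (\<bar>h x\<bar> powr p + \<bar>c\<bar> powr p))"
    using assms by simp
  have "\<bar>t - c\<bar> powr p \<le> 2 powr p * (\<bar>t\<bar> powr p + \<bar>c\<bar> powr p)" for t :: real
  proof -
    have "\<bar>t - c\<bar> powr p \<le> (\<bar>t\<bar> + \<bar>c\<bar>) powr p"
      using assms by (intro powr_mono2) auto
    also have "\<dots> \<le> 2 powr p * (\<bar>t\<bar> powr p + \<bar>c\<bar> powr p)"
      using assms by (intro powr_add_le) auto
    finally show ?thesis .
  qed
  then show "AE x in M. norm (\<bar>h x - c\<bar> powr p)
      \<le> norm (2 powr p * (\<bar>h x\<bar> powr p + \<bar>c\<bar> powr p))"
    by simp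
qed (use assms in measurable)

text \<open>
  Integrate the tangent inequality at the mean \<open>m\<close>: the linear term integrates to zero. If the
  space has mass zero, then \<open>m = 0\<close> by division by zero and the claim is trivial.
\<close>

lemma (in finite_measure) jensen_powr_mean:
  fixes h :: "'a \<Rightarrow> real"
  assumes h: "h \<in> borel_measurable M" "integrable M (\<lambda>x. \<bar>h x\<bar> powr p)" and p: "1 \<le> p"
  shows "((LINT x|M. \<bar>h x\<bar>) / measure M (space M)) powr p * measure M (space M)
    \<le> (LINT x|M. \<bar>h x\<bar> powr p)"
proof -
  define m where "m = (LINT x|M. \<bar>h x\<bar>) / measure M (space M)"
  have int: "integrable M (\<lambda>x. \<bar>h x\<bar>)"
    using integrable_of_integrable_powr[OF h p] by simp
  have "m \<ge> 0"
    by (simp add: m_def)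
  show ?thesis
  proof (cases "m = 0")
    case True
    then show ?thesis
      using p unfolding m_def[symmetric] by simp
  next
    case False
    then have m: "m > 0"
      using \<open>m \<ge> 0\<close> by simp
    have mass: "measure M (space M) \<noteq> 0"
      using False by (auto simp: m_def)
    have mean: "(LINT x|M. \<bar>h x\<bar>) = m * measure M (space M)"
      using mass by (simp add: m_def)
    have "m powr p * measure M (space M)
        = (LINT x|M. m powr p + p * m powr (p - 1) * (\<bar>h x\<bar> - m))"
      using int by (simp add: mean)
    also have "\<dots> \<le> (LINT x|M. \<bar>h x\<bar> powr p)"
      using int h p m by (intro integral_mono powr_above_tangent) auto
    finally show ?thesis
      by (simp add: m_def)
  qed
qed

lemma measure_space_lebesgue_on:
  assumes "E \<in> sets lebesgue"
  shows "measure (lebesgue_on E) (space (lebesgue_on E)) = measure lebesgue E"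
  using assms by (simp add: measure_restrict_space)

lemma integrable_lebesgue_on_subset:
  fixes f :: "'a::euclidean_space \<Rightarrow> real"
  assumes "integrable (lebesgue_on E) f" "D \<subseteq> E" "D \<in> sets lebesgue" "E \<in> sets lebesgue"
  shows "integrable (lebesgue_on D) f"
  using set_integrable_subset[of lebesgue E f D] assms
  by (simp add: set_integrable_def integrable_restrict_space)

lemma integral_lebesgue_on_mono_set:
  fixes f :: "'a::euclidean_space \<Rightarrow> real"
  assumes "integrable (lebesgue_on E) f" "D \<subseteq> E" "D \<in> sets lebesgue" "E \<in> sets lebesgue"
    and "\<And>x. 0 \<le> f x"
  shows "(LINT x|lebesgue_on D. f x) \<le> (LINT x|lebesgue_on E. f x)"
proof -
  have "integrable (lebesgue_on D) f"
    using assms(1-4) by (rule integrable_lebesgue_on_subset)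
  then have "(LINT x|lebesgue. indicator D x *\<^sub>R f x) \<le> (LINT x|lebesgue. indicator E x *\<^sub>R f x)"
    using assms by (intro integral_mono) (auto simp: integrable_restrict_space indicator_def)
  then show ?thesis
    using assms by (simp add: integral_restrict_space)
qed

lemma abs_mean_nonneg: "abs_mean f E \<ge> 0"
  by (simp add: abs_mean_def)

lemma abs_mean_powr_le:
  assumes "E \<in> lmeasurable" "f \<in> Lp p E" "1 \<le> p"
  shows "abs_mean f E powr p * measure lebesgue E \<le> (LINT x|lebesgue_on E. \<bar>f x\<bar> powr p)"
proof -
  interpret finite_measure "lebesgue_on E"
    using assms by (intro finite_measure_lebesgue_on)
  show ?thesis
    using jensen_powr_mean[OF _ _ assms(3), of f] assms(2)
    unfolding abs_mean_def Lp_def measure_space_lebesgue_on[OF fmeasurableD[OF assms(1)]] by blast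
qed

lemma Lp_mono_set:
  assumes "f \<in> Lp p E" "D \<subseteq> E" "D \<in> sets lebesgue" "E \<in> sets lebesgue"
  shows "f \<in> Lp p D"
  using assms(1) measurable_restrict_mono[OF _ assms(2), of f lebesgue borel]
    integrable_lebesgue_on_subset[OF _ assms(2-4), of "\<lambda>x. \<bar>f x\<bar> powr p"]
  unfolding Lp_def by blast

lemma Lp_diff_const:
  assumes "E \<in> lmeasurable" "f \<in> Lp p E" "1 \<le> p"
  shows "(\<lambda>x. f x - c) \<in> Lp p E"
proof -
  interpret finite_measure "lebesgue_on E"
    using assms by (intro finite_measure_lebesgue_on)
  show ?thesis
    using integrable_powr_diff_const[of f p c] assms by (auto simp: Lp_def)
qed

lemma abs_mean_diff_le:
  assumes E: "E \<in> lmeasurable" "measure lebesgue E > 0" and f: "f \<in> Lp p E" "1 \<le> p" and c: "c \<ge> 0"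
  shows "\<bar>abs_mean f E - c\<bar> \<le> abs_mean (\<lambda>x. f x - c) E"
proof -
  interpret finite_measure "lebesgue_on E"
    using E by (intro finite_measure_lebesgue_on)
  have int: "integrable (lebesgue_on E) f"
    using f by (intro integrable_of_integrable_powr[of f p]) (auto simp: Lp_def)
  have "abs_mean f E - c = (LINT x|lebesgue_on E. \<bar>f x\<bar> - c) / measure lebesgue E"
    using int E
    by (simp add: abs_mean_def fmeasurableD diff_divide_distrib measure_restrict_space)
  also have "\<bar>\<dots>\<bar> \<le> (LINT x|lebesgue_on E. \<bar>\<bar>f x\<bar> - c\<bar>) / measure lebesgue E"
    by (simp add: divide_right_mono integral_abs_bound)
  also have "\<dots> \<le> (LINT x|lebesgue_on E. \<bar>f x - c\<bar>) / measure lebesgue E"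
    using int c by (intro divide_right_mono integral_mono) auto
  finally show ?thesis
    by (simp add: abs_mean_def)
qed

text \<open>
  Jensen's inequality for \<open>f - c\<close> on \<open>D\<close>, after which the domain of integration is enlarged to \<open>E\<close>.
  With \<open>c\<close> the mean over \<open>E\<close> this compares the means at two scales.
\<close>

lemma abs_mean_osc_le:
  assumes D: "D \<in> lmeasurable" "measure lebesgue D > 0" "D \<subseteq> E" and E: "E \<in> lmeasurable"
    and f: "f \<in> Lp p E" "1 \<le> p" and c: "c \<ge> 0"
  shows "\<bar>abs_mean f D - c\<bar> powr p * measure lebesgue D
    \<le> (LINT x|lebesgue_on E. \<bar>f x - c\<bar> powr p)"
proof -
  have fD: "f \<in> Lp p D"
    using Lp_mono_set[OF f(1) D(3)] D E by (simp add: fmeasurableD)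
  have "\<bar>abs_mean f D - c\<bar> powr p * measure lebesgue D
      \<le> abs_mean (\<lambda>x. f x - c) D powr p * measure lebesgue D"
    using abs_mean_diff_le[OF D(1,2) fD f(2) c] f by (intro mult_right_mono powr_mono2) auto
  also have "\<dots> \<le> (LINT x|lebesgue_on D. \<bar>f x - c\<bar> powr p)"
    using D fD f by (intro abs_mean_powr_le Lp_diff_const)
  also have "\<dots> \<le> (LINT x|lebesgue_on E. \<bar>f x - c\<bar> powr p)"
    using D E Lp_diff_const[OF E f]
    by (intro integral_lebesgue_on_mono_set) (auto simp: Lp_def fmeasurableD)
  finally show ?thesis .
qed

text \<open>
  Both inclusions use this: with \<open>c\<close> a mean of \<open>\<bar>f\<bar>\<close>, one takes \<open>g = f\<close> and \<open>h = f - c\<close>, the other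
  \<open>g = f - c\<close> and \<open>h = f\<close>.
\<close>

lemma integral_powr_add_const_le:
  assumes E: "E \<in> lmeasurable" and g: "g \<in> Lp p E" "1 \<le> p"
    and h: "h \<in> Lp p E" and le: "\<And>x. \<bar>h x\<bar> \<le> \<bar>g x\<bar> + c" and c: "c \<ge> 0"
  shows "(LINT x|lebesgue_on E. \<bar>h x\<bar> powr p)
    \<le> 2 powr p * ((LINT x|lebesgue_on E. \<bar>g x\<bar> powr p) + c powr p * measure lebesgue E)"
proof -
  interpret finite_measure "lebesgue_on E"
    using E by (intro finite_measure_lebesgue_on)
  have "\<bar>h x\<bar> powr p \<le> 2 powr p * (\<bar>g x\<bar> powr p + c powr p)" for x
  proof -
    have "\<bar>h x\<bar> powr p \<le> (\<bar>g x\<bar> + c) powr p"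
      using le[of x] g(2) by (intro powr_mono2) auto
    also have "\<dots> \<le> 2 powr p * (\<bar>g x\<bar> powr p + c powr p)"
      using g(2) c by (intro powr_add_le) auto
    finally show ?thesis .
  qed
  then have "(LINT x|lebesgue_on E. \<bar>h x\<bar> powr p)
      \<le> (LINT x|lebesgue_on E. 2 powr p * (\<bar>g x\<bar> powr p + c powr p))"
    using g h by (intro integral_mono) (auto simp: Lp_def)
  also have "\<dots> = 2 powr p * ((LINT x|lebesgue_on E. \<bar>g x\<bar> powr p) + c powr p * measure lebesgue E)"
    using g E by (simp add: Lp_def fmeasurableD measure_restrict_space)
  finally show ?thesis .
qed

section \<open>Cubes and the two function spaces\<close>

lemma measure_cube:
  fixes x :: "real ^ 'n"
  assumes "\<rho> > 0"
  shows "measure lebesgue (cube x \<rho>) = (2 * \<rho>) ^ CARD('n)"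
proof -
  have "cbox (x - vec \<rho>) (x + vec \<rho>) \<noteq> {}"
    using assms by (auto simp: interval_ne_empty_cart)
  then have "measure lborel (cbox (x - vec \<rho>) (x + vec \<rho>)) = (\<Prod>i\<in>(UNIV::'n set). 2 * \<rho>)"
    by (simp add: content_cbox_cart)
  then show ?thesis
    by (simp add: cube_def measure_lborel_box_eq measure_lborel_cbox_eq)
qed

lemma subcube_lmeasurable:
  assumes "open \<Omega>"
  shows "subcube \<Omega> x \<rho> \<in> lmeasurable"
  using assms unfolding subcube_def cube_def
  by (intro lmeasurable_open bounded_Int) auto

lemma measure_subcube_le:
  fixes \<Omega> :: "(real ^ 'n) set"
  assumes "open \<Omega>" "\<rho> > 0"
  shows "measure lebesgue (subcube \<Omega> x \<rho>) \<le> (2 * \<rho>) ^ CARD('n)"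
proof -
  have "measure lebesgue (subcube \<Omega> x \<rho>) \<le> measure lebesgue (cube x \<rho>)"
    using subcube_lmeasurable[OF assms(1)] lmeasurable_box
    by (intro measure_mono_fmeasurable) (auto simp: subcube_def cube_def fmeasurableD)
  then show ?thesis
    using assms by (simp add: measure_cube)
qed

lemma subcube_mono:
  assumes "\<rho> \<le> \<sigma>"
  shows "subcube \<Omega> x \<rho> \<subseteq> subcube \<Omega> x \<sigma>"
proof
  fix y assume "y \<in> subcube \<Omega> x \<rho>"
  then have "y \<in> \<Omega>" and i: "x $ i - \<rho> < y $ i \<and> y $ i < x $ i + \<rho>" for i
    by (auto simp: subcube_def cube_def mem_box_cart)
  moreover have "x $ i - \<sigma> < y $ i \<and> y $ i < x $ i + \<sigma>" for i
    using i[of i] assms by linarith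
  ultimately show "y \<in> subcube \<Omega> x \<sigma>"
    by (simp add: subcube_def cube_def mem_box_cart)
qed

text \<open>
  Translates the finiteness of the defining suprema, which live in the extended reals, into a
  uniform real bound on Bochner integrals. It is stated for a family of integrands that may depend
  on the cube, as the Campanato integrand does.
\<close>

lemma SUP_scaled_nn_integral_finite_iff:
  fixes F :: "'a::euclidean_space \<Rightarrow> real \<Rightarrow> 'a \<Rightarrow> real"
  assumes "\<And>x \<rho>. x \<in> \<Omega> \<Longrightarrow> \<rho> > 0 \<Longrightarrow> integrable (lebesgue_on (S x \<rho>)) (F x \<rho>)"
    and "\<And>x \<rho> y. F x \<rho> y \<ge> 0"
  shows "(SUP (x, \<rho>) \<in> \<Omega> \<times> {0<..}. ennreal (\<rho> powr (- \<kappa>)) *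
            (\<integral>\<^sup>+ y. ennreal (F x \<rho> y) \<partial>lebesgue_on (S x \<rho>))) < \<infinity>
    \<longleftrightarrow> (\<exists>C\<ge>0. \<forall>x\<in>\<Omega>. \<forall>\<rho>>0. (LINT y|lebesgue_on (S x \<rho>). F x \<rho> y) \<le> C * \<rho> powr \<kappa>)"
    (is "?S < \<infinity> \<longleftrightarrow> ?B")
proof -
  let ?I = "\<lambda>x \<rho>. LINT y|lebesgue_on (S x \<rho>). F x \<rho> y"
  have conv: "ennreal (\<rho> powr (- \<kappa>)) * (\<integral>\<^sup>+ y. ennreal (F x \<rho> y) \<partial>lebesgue_on (S x \<rho>))
      = ennreal (?I x \<rho> / \<rho> powr \<kappa>)" if "x \<in> \<Omega>" "\<rho> > 0" for x \<rho>
    using assms that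
    by (simp add: nn_integral_eq_integral ennreal_mult[symmetric] integral_nonneg_AE powr_minus field_simps)
  have eq: "?S = (SUP (x, \<rho>) \<in> \<Omega> \<times> {0<..}. ennreal (?I x \<rho> / \<rho> powr \<kappa>))"
    by (intro SUP_cong refl) (auto simp: conv)
  show ?thesis
  proof
    assume "?S < \<infinity>"
    then obtain C where C: "C \<ge> 0" "?S = ennreal C"
      by (cases ?S) auto
    have "?I x \<rho> \<le> C * \<rho> powr \<kappa>" if "x \<in> \<Omega>" "\<rho> > 0" for x \<rho>
    proof -
      have "ennreal (?I x \<rho> / \<rho> powr \<kappa>) \<le> ennreal C"
        unfolding C(2)[symmetric] eq using that by (intro SUP_upper2[of "(x, \<rho>)"]) auto
      then show ?thesis
        using C that by (simp add: field_simps)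
    qed
    then show ?B
      using C by blast
  next
    assume ?B
    then obtain C where C: "C \<ge> 0" "\<And>x \<rho>. x \<in> \<Omega> \<Longrightarrow> \<rho> > 0 \<Longrightarrow> ?I x \<rho> \<le> C * \<rho> powr \<kappa>"
      by blast
    have "?S \<le> ennreal C"
      unfolding eq using C by (auto intro!: SUP_least ennreal_leI simp: field_simps)
    then show "?S < \<infinity>"
      by (simp add: le_less_trans)
  qed
qed

lemma Lp_subcube:
  assumes "open \<Omega>" "f \<in> Lp p \<Omega>"
  shows "f \<in> Lp p (subcube \<Omega> x \<rho>)"
proof (rule Lp_mono_set[OF assms(2)])
  show "subcube \<Omega> x \<rho> \<in> sets lebesgue" "\<Omega> \<in> sets lebesgue"
    using assms subcube_lmeasurable[OF assms(1), of x \<rho>] by (auto simp: fmeasurableD)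
qed (simp add: subcube_def)

lemma morrey_iff:
  assumes "open \<Omega>"
  shows "f \<in> morrey p \<kappa> \<Omega> \<longleftrightarrow> f \<in> Lp p \<Omega> \<and>
    (\<exists>C\<ge>0. \<forall>x\<in>\<Omega>. \<forall>\<rho>>0. (LINT y|lebesgue_on (subcube \<Omega> x \<rho>). \<bar>f y\<bar> powr p) \<le> C * \<rho> powr \<kappa>)"
proof (cases "f \<in> Lp p \<Omega>")
  case True
  have "integrable (lebesgue_on (subcube \<Omega> x \<rho>)) (\<lambda>y. \<bar>f y\<bar> powr p)" for x \<rho>
    using Lp_subcube[OF assms True, of x \<rho>] by (simp add: Lp_def)
  then show ?thesis
    using True SUP_scaled_nn_integral_finite_iff
      [of \<Omega> "subcube \<Omega>" "\<lambda>x \<rho> y. \<bar>f y\<bar> powr p" \<kappa>]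
    by (simp add: morrey_def)
qed (simp add: morrey_def)

lemma abs_campanato_iff:
  assumes "open \<Omega>" "1 \<le> p"
  shows "f \<in> abs_campanato p \<kappa> \<Omega> \<longleftrightarrow> f \<in> Lp p \<Omega> \<and>
    (\<exists>C\<ge>0. \<forall>x\<in>\<Omega>. \<forall>\<rho>>0. (LINT y|lebesgue_on (subcube \<Omega> x \<rho>).
        \<bar>f y - abs_mean f (subcube \<Omega> x \<rho>)\<bar> powr p) \<le> C * \<rho> powr \<kappa>)"
proof (cases "f \<in> Lp p \<Omega>")
  case True
  have "integrable (lebesgue_on (subcube \<Omega> x \<rho>)) (\<lambda>y. \<bar>f y - c\<bar> powr p)" for x \<rho> c
    using Lp_diff_const[OF subcube_lmeasurable[OF assms(1), of x \<rho>]
        Lp_subcube[OF assms(1) True] assms(2)]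
    by (simp add: Lp_def)
  then show ?thesis
    using True SUP_scaled_nn_integral_finite_iff
      [of \<Omega> "subcube \<Omega>" "\<lambda>x \<rho> y. \<bar>f y - abs_mean f (subcube \<Omega> x \<rho>)\<bar> powr p" \<kappa>]
    by (simp add: abs_campanato_def)
qed (simp add: abs_campanato_def)

section \<open>The two inclusions\<close>

lemma morrey_subset_abs_campanato:
  assumes "open \<Omega>" "1 \<le> p"
  shows "morrey p \<kappa> \<Omega> \<subseteq> abs_campanato p \<kappa> \<Omega>"
proof
  fix f assume "f \<in> morrey p \<kappa> \<Omega>"
  then obtain C where f: "f \<in> Lp p \<Omega>" and C: "C \<ge> 0"
    "\<And>x \<rho>. x \<in> \<Omega> \<Longrightarrow> \<rho> > 0 \<Longrightarrow> (LINT y|lebesgue_on (subcube \<Omega> x \<rho>). \<bar>f y\<bar> powr p) \<le> C * \<rho> powr \<kappa>"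
    using morrey_iff[OF assms(1)] by blast
  have "(LINT y|lebesgue_on (subcube \<Omega> x \<rho>). \<bar>f y - abs_mean f (subcube \<Omega> x \<rho>)\<bar> powr p)
      \<le> (2 powr p * (2 * C)) * \<rho> powr \<kappa>" if "x \<in> \<Omega>" "\<rho> > 0" for x \<rho>
  proof -
    let ?E = "subcube \<Omega> x \<rho>"
    let ?I = "LINT y|lebesgue_on ?E. \<bar>f y\<bar> powr p"
    have E: "?E \<in> lmeasurable" and fE: "f \<in> Lp p ?E"
      using subcube_lmeasurable[OF assms(1)] Lp_subcube[OF assms(1) f] by blast+
    have "(LINT y|lebesgue_on ?E. \<bar>f y - abs_mean f ?E\<bar> powr p)
        \<le> 2 powr p * (?I + abs_mean f ?E powr p * measure lebesgue ?E)"
    proof (rule integral_powr_add_const_le)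
      show "\<bar>f y - abs_mean f ?E\<bar> \<le> \<bar>f y\<bar> + abs_mean f ?E" for y
        using abs_mean_nonneg[of f ?E] by linarith
    qed (use E fE assms abs_mean_nonneg Lp_diff_const in auto)
    also have "\<dots> \<le> 2 powr p * (?I + ?I)"
      using abs_mean_powr_le[OF E fE assms(2)] by (intro mult_left_mono add_mono) auto
    also have "\<dots> \<le> 2 powr p * (C * \<rho> powr \<kappa> + C * \<rho> powr \<kappa>)"
      using C(2)[OF that] by (intro mult_left_mono add_mono) auto
    finally show ?thesis
      by (simp add: algebra_simps)
  qed
  moreover have "2 powr p * (2 * C) \<ge> 0"
    using C by simp
  ultimately show "f \<in> abs_campanato p \<kappa> \<Omega>"
    using abs_campanato_iff[OF assms] f by blast
qed

text \<open>
  The mean over the smaller cube is compared with the centre of oscillation of the larger one; the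
  \<open>p\<close>-th power of the difference is at most \<open>C (2\<rho>)\<^sup>\<kappa> / (A \<rho>\<^sup>n)\<close>.
\<close>

lemma abs_mean_subcube_doubling:
  fixes \<Omega> :: "(real ^ 'n) set" and A C p \<kappa> :: real
  assumes "open \<Omega>" "1 \<le> p" "f \<in> Lp p \<Omega>" "A > 0" "C \<ge> 0" "\<rho> > 0"
    and dens: "A * \<rho> ^ CARD('n) \<le> measure lebesgue (subcube \<Omega> x \<rho>)"
    and osc: "(LINT y|lebesgue_on (subcube \<Omega> x (2 * \<rho>)).
        \<bar>f y - abs_mean f (subcube \<Omega> x (2 * \<rho>))\<bar> powr p) \<le> C * (2 * \<rho>) powr \<kappa>"
  shows "abs_mean f (subcube \<Omega> x \<rho>) \<le> abs_mean f (subcube \<Omega> x (2 * \<rho>))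
    + (C * 2 powr \<kappa> / A) powr (1 / p) * \<rho> powr (- ((real CARD('n) - \<kappa>) / p))"
proof -
  let ?D = "subcube \<Omega> x \<rho>" and ?E = "subcube \<Omega> x (2 * \<rho>)"
  define d where "d = \<bar>abs_mean f ?D - abs_mean f ?E\<bar>"
  have "0 < A * \<rho> ^ CARD('n)"
    using assms by simp
  then have pos: "measure lebesgue ?D > 0"
    using dens by linarith
  have "d powr p * (A * \<rho> ^ CARD('n)) \<le> d powr p * measure lebesgue ?D"
    using dens by (intro mult_left_mono) auto
  also have "\<dots> \<le> (LINT y|lebesgue_on ?E. \<bar>f y - abs_mean f ?E\<bar> powr p)"
    unfolding d_def using assms pos abs_mean_nonneg
    by (intro abs_mean_osc_le subcube_lmeasurable subcube_mono Lp_subcube) auto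
  also have "\<dots> \<le> C * (2 * \<rho>) powr \<kappa>"
    by (rule osc)
  finally have "d powr p \<le> (C * 2 powr \<kappa> / A) * \<rho> powr (\<kappa> - CARD('n))"
    using assms by (simp add: powr_mult powr_diff powr_realpow field_simps)
  then have "d \<le> (C * 2 powr \<kappa> / A) powr (1 / p) * \<rho> powr ((\<kappa> - CARD('n)) / p)"
    using assms by (intro powr_le_imp_le_root) (auto simp: d_def)
  also have "(\<kappa> - CARD('n)) / p = - ((real CARD('n) - \<kappa>) / p)"
    by (simp add: minus_divide_left)
  finally show ?thesis
    by (simp add: d_def)
qed

text \<open>
  The density condition enters only below one fixed scale \<open>R\<close>: it starts the dyadic chain at \<open>\<rho>\<close>,
  and ends it in \<open>[R/2, R)\<close>, where Jensen's inequality bounds the mean by the global norm.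
\<close>

lemma abs_campanato_subset_morrey:
  fixes \<Omega> :: "(real ^ 'n) set" and A R p \<kappa> :: real
  assumes \<Omega>: "open \<Omega>" and p: "1 \<le> p" and \<kappa>: "0 \<le> \<kappa>" "\<kappa> < real CARD('n)"
    and A: "A > 0" and R: "R > 0"
    and dens: "\<And>x \<rho>. x \<in> \<Omega> \<Longrightarrow> 0 < \<rho> \<Longrightarrow> \<rho> < R \<Longrightarrow>
      A * \<rho> ^ CARD('n) \<le> measure lebesgue (subcube \<Omega> x \<rho>)"
  shows "abs_campanato p \<kappa> \<Omega> \<subseteq> morrey p \<kappa> \<Omega>"
proof
  fix f assume "f \<in> abs_campanato p \<kappa> \<Omega>"
  then obtain C where f: "f \<in> Lp p \<Omega>" and C: "C \<ge> 0"
    "\<And>x \<rho>. x \<in> \<Omega> \<Longrightarrow> \<rho> > 0 \<Longrightarrow> (LINT y|lebesgue_on (subcube \<Omega> x \<rho>).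
        \<bar>f y - abs_mean f (subcube \<Omega> x \<rho>)\<bar> powr p) \<le> C * \<rho> powr \<kappa>"
    using abs_campanato_iff[OF \<Omega> p] by blast
  define N where "N = (LINT y|lebesgue_on \<Omega>. \<bar>f y\<bar> powr p)"
  define \<alpha> where "\<alpha> = (real CARD('n) - \<kappa>) / p"
  define K where "K = (C * 2 powr \<kappa> / A) powr (1 / p)"
  \<comment> \<open>\<open>L\<close> bounds the means at scales in \<open>[R/2, R)\<close>; the factor \<open>R powr \<alpha>\<close> in \<open>K'\<close> turns this constant
    into a multiple of \<open>\<rho> powr (-\<alpha>)\<close>, which is larger than \<open>R powr (-\<alpha>)\<close> for \<open>\<rho> < R\<close>.\<close>
  define L where "L = (N / (A * (R / 2) ^ CARD('n))) powr (1 / p)"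
  define K' where "K' = L * R powr \<alpha> + K / (1 - 2 powr (- \<alpha>))"
  define B where "B = 2 powr p * (C + K' powr p * 2 ^ CARD('n))"
  have "N \<ge> 0" "L \<ge> 0" "K \<ge> 0" "\<alpha> > 0"
    using p \<kappa> by (auto simp: N_def L_def K_def \<alpha>_def)
  moreover have "2 powr (- \<alpha>) < 1"
    using \<open>\<alpha> > 0\<close> by (simp add: powr_less_one)
  ultimately have "K' \<ge> 0"
    by (simp add: K'_def)
  have "B \<ge> 0"
    using C by (simp add: B_def)
  have total: "(LINT y|lebesgue_on (subcube \<Omega> x \<rho>). \<bar>f y\<bar> powr p) \<le> N" for x \<rho>
    unfolding N_def using f \<Omega> subcube_lmeasurable[OF \<Omega>, of x \<rho>]
    by (intro integral_lebesgue_on_mono_set) (auto simp: Lp_def subcube_def fmeasurableD)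
  have top: "abs_mean f (subcube \<Omega> x \<rho>) \<le> L" if "x \<in> \<Omega>" "R / 2 \<le> \<rho>" "\<rho> < R" for x \<rho>
  proof -
    let ?E = "subcube \<Omega> x \<rho>"
    let ?m = "abs_mean f ?E"
    have "?m powr p * (A * (R / 2) ^ CARD('n)) \<le> ?m powr p * (A * \<rho> ^ CARD('n))"
      using that A R by (intro mult_left_mono power_mono) auto
    also have "\<dots> \<le> ?m powr p * measure lebesgue ?E"
      using dens[of x \<rho>] that R by (intro mult_left_mono) auto
    also have "\<dots> \<le> N"
      using abs_mean_powr_le[OF subcube_lmeasurable[OF \<Omega>] Lp_subcube[OF \<Omega> f] p] total order_trans
      by blast
    \<comment> \<open>The trivial factor gives the inequality the shape needed to take the \<open>p\<close>-th root.\<close>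
    finally have "?m powr p \<le> N / (A * (R / 2) ^ CARD('n)) * 1 powr 0"
      using A R by (simp add: field_simps)
    then show ?thesis
      using powr_le_imp_le_root[of ?m "N / (A * (R / 2) ^ CARD('n))" 1 p 0]
        abs_mean_nonneg[of f ?E] \<open>N \<ge> 0\<close> A R p by (simp add: L_def)
  qed
  have mean: "abs_mean f (subcube \<Omega> x \<rho>) \<le> K' * \<rho> powr (- \<alpha>)"
    if x: "x \<in> \<Omega>" and \<rho>: "0 < \<rho>" "\<rho> < R" for x \<rho>
  proof -
    obtain k where k: "R / 2 \<le> 2 ^ k * \<rho>" "2 ^ k * \<rho> < R"
      using dyadic_multiple_in_top_octave[OF \<rho>] .
    have step: "abs_mean f (subcube \<Omega> x r) \<le> abs_mean f (subcube \<Omega> x (2 * r)) + K * r powr (- \<alpha>)"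
      if "0 < r" "2 * r < R" for r
      unfolding K_def \<alpha>_def using \<Omega> p f A C x dens that
      by (intro abs_mean_subcube_doubling) auto
    have "abs_mean f (subcube \<Omega> x \<rho>)
        \<le> abs_mean f (subcube \<Omega> x (2 ^ k * \<rho>)) + K / (1 - 2 powr (- \<alpha>)) * \<rho> powr (- \<alpha>)"
      using dyadic_growth_bound[OF step \<open>\<alpha> > 0\<close> \<open>K \<ge> 0\<close> \<rho>(1) k(2)] .
    also have "abs_mean f (subcube \<Omega> x (2 ^ k * \<rho>)) \<le> L"
      using top x k by blast
    also have "L = L * R powr \<alpha> * R powr (- \<alpha>)"
      using R by (simp add: powr_minus)
    also have "\<dots> \<le> L * R powr \<alpha> * \<rho> powr (- \<alpha>)"
      using \<open>L \<ge> 0\<close> \<open>\<alpha> > 0\<close> \<rho> by (intro mult_left_mono powr_mono2') auto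
    finally show ?thesis
      by (simp add: K'_def algebra_simps)
  qed
  have "(LINT y|lebesgue_on (subcube \<Omega> x \<rho>). \<bar>f y\<bar> powr p) \<le> max B (N / R powr \<kappa>) * \<rho> powr \<kappa>"
    if x: "x \<in> \<Omega>" and \<rho>: "\<rho> > 0" for x \<rho>
  proof (cases "\<rho> < R")
    case True
    let ?E = "subcube \<Omega> x \<rho>"
    let ?m = "abs_mean f ?E"
    have E: "?E \<in> lmeasurable" and fE: "f \<in> Lp p ?E"
      using subcube_lmeasurable[OF \<Omega>] Lp_subcube[OF \<Omega> f] by blast+
    have "(LINT y|lebesgue_on ?E. \<bar>f y\<bar> powr p)
        \<le> 2 powr p * ((LINT y|lebesgue_on ?E. \<bar>f y - ?m\<bar> powr p) + ?m powr p * measure lebesgue ?E)"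
    proof (rule integral_powr_add_const_le)
      show "\<bar>f y\<bar> \<le> \<bar>f y - ?m\<bar> + ?m" for y
        using abs_mean_nonneg[of f ?E] by linarith
    qed (use E fE p abs_mean_nonneg Lp_diff_const in auto)
    also have "\<dots> \<le> 2 powr p * (C * \<rho> powr \<kappa> + (K' * \<rho> powr (- \<alpha>)) powr p * (2 * \<rho>) ^ CARD('n))"
      using C(2)[OF x \<rho>] mean[OF x \<rho> True] measure_subcube_le[OF \<Omega> \<rho>, of x] p
      by (intro mult_left_mono add_mono mult_mono powr_mono2 abs_mean_nonneg) auto
    also have "(K' * \<rho> powr (- \<alpha>)) powr p * (2 * \<rho>) ^ CARD('n) = K' powr p * 2 ^ CARD('n) * \<rho> powr \<kappa>"
    proof -
      \<comment> \<open>The exponents match because \<open>p \<alpha> = n - \<kappa>\<close>.\<close>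
      have "(\<rho> powr (- \<alpha>)) powr p * \<rho> ^ CARD('n) = \<rho> powr \<kappa>"
        using p \<rho> by (simp add: powr_powr \<alpha>_def powr_realpow[symmetric] powr_add[symmetric])
      then show ?thesis
        using \<open>K' \<ge> 0\<close> by (simp add: powr_mult power_mult_distrib mult_ac)
    qed
    also have "2 powr p * (C * \<rho> powr \<kappa> + K' powr p * 2 ^ CARD('n) * \<rho> powr \<kappa>) = B * \<rho> powr \<kappa>"
      by (simp add: B_def algebra_simps)
    also have "\<dots> \<le> max B (N / R powr \<kappa>) * \<rho> powr \<kappa>"
      by (intro mult_right_mono) auto
    finally show ?thesis .
  next
    case False
    have "(LINT y|lebesgue_on (subcube \<Omega> x \<rho>). \<bar>f y\<bar> powr p) \<le> N / R powr \<kappa> * R powr \<kappa>"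
      using total R by simp
    also have "\<dots> \<le> max B (N / R powr \<kappa>) * \<rho> powr \<kappa>"
      using False R \<kappa> \<open>B \<ge> 0\<close> by (intro mult_mono powr_mono2) auto
    finally show ?thesis .
  qed
  moreover have "max B (N / R powr \<kappa>) \<ge> 0"
    using \<open>B \<ge> 0\<close> by simp
  ultimately show "f \<in> morrey p \<kappa> \<Omega>"
    using morrey_iff[OF \<Omega>] f by blast
qed

lemma open_ediameter_pos:
  fixes \<Omega> :: "(real ^ 'n) set"
  assumes "open \<Omega>" "\<Omega> \<noteq> {}"
  obtains R where "R > 0" "ennreal R \<le> ediameter \<Omega>"
proof -
  obtain x where x: "x \<in> \<Omega>"
    using assms by blast
  have "\<Omega> \<noteq> {x}"
    using assms not_open_singleton by blast
  then obtain y where "y \<in> \<Omega>" "x \<noteq> y"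
    using x by blast
  then have "dist x y > 0" "ennreal (dist x y) \<le> ediameter \<Omega>"
    unfolding ediameter_def using x by (auto intro!: SUP_upper2[of "(x, y)"])
  then show ?thesis
    using that by blast
qed

theorem theorem2p1:
  fixes \<Omega> :: "(real ^ 'n) set" and A p \<kappa> :: real
  assumes "open \<Omega>" and "connected \<Omega>" and "\<Omega> \<noteq> {}"
    and "A > 0"
    and "\<And>x\<^sub>0 \<rho>. x\<^sub>0 \<in> \<Omega> \<Longrightarrow> \<rho> > 0 \<Longrightarrow> ennreal \<rho> < ediameter \<Omega> \<Longrightarrow>
           measure lebesgue (subcube \<Omega> x\<^sub>0 \<rho>) \<ge> A * \<rho> ^ CARD('n)"
    and "1 \<le> p" and "0 \<le> \<kappa>" and "\<kappa> < real CARD('n)"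
  shows "morrey p \<kappa> \<Omega> = abs_campanato p \<kappa> \<Omega>"
proof
  show "morrey p \<kappa> \<Omega> \<subseteq> abs_campanato p \<kappa> \<Omega>"
    using assms by (intro morrey_subset_abs_campanato)
  obtain R where R: "R > 0" "ennreal R \<le> ediameter \<Omega>"
    using open_ediameter_pos[OF \<open>open \<Omega>\<close> \<open>\<Omega> \<noteq> {}\<close>] .
  show "abs_campanato p \<kappa> \<Omega> \<subseteq> morrey p \<kappa> \<Omega>"
  proof (rule abs_campanato_subset_morrey[where A = A and R = R])
    fix x \<rho> assume x: "x \<in> \<Omega>" "0 < \<rho>" "\<rho> < R"
    then have "ennreal \<rho> < ediameter \<Omega>"
      using R by (intro less_le_trans[OF ennreal_lessI]) auto
    then show "A * \<rho> ^ CARD('n) \<le> measure lebesgue (subcube \<Omega> x \<rho>)"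
      using assms(5) x by blast
  qed (use assms R in auto)
qed

end
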